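(* Let $k>d$ and let $\tau=\tau'\mbox{-}k\mbox{-}\tau''\mbox{-}d$ be a generalized pattern on the letters $\{1,\dots,k\}$, where $\tau'$ and $\tau''$ are the (generalized-pattern) segments of $\tau$ indicated, such that the minimal letter of $\tau'$ is $d+1$. Then $$F_\tau(x)=\cfrac{1}{1-x\,\cfrac{1-xF_{\tau'}(x)F_{\tau''}(x)}{1-x\bigl(F_{\tau'}(x)+F_{\tau''}(x)\bigr)}}.$$
   Context: A generalized pattern is a sequence of distinct positive integers written as a word $\tau_1\cdots\tau_m$ in which each pair of adjacent letters may or may not be separated by a dash "-". A permutation $\pi=\pi_1\cdots\pi_n\in S_n$ contains $\tau$ if there are indices $i_1<\dots<i_m$ with $(\pi_{i_1},\dots,\pi_{i_m})$ order-isomorphic to $(\tau_1,\dots,\tau_m)$ and $i_{j+1}=i_j+1$ whenever $\tau_j,\tau_{j+1}$ are not separated by a dash; otherwise $\pi$ avoids $\tau$ (every permutation contains the empty pattern). Thus $1\mbox{-}3\mbox{-}2$ is the classical pattern $132$. $F_\tau(x)=\sum_{n\geq0}f_\tau(n)x^n$, where $f_\tau(n)$ is the number of permutations in $S_n$ ($S_0$ = the empty permutation) avoiding both $1\mbox{-}3\mbox{-}2$ and $\tau$; this depends only on the order-isomorphism type of $\tau$ (with its dashes).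
   Formalization: Added assumption: if the word τ contains 1-3-2, then τ' or τ'' already contains 1-3-2. Without it the claim fails, e.g. for τ = 2-4-3-1, where the x^4 coefficient of F_τ is 14 but the formula gives 13; exactly the false instances are excluded. *)

theory Defs
  imports
    "HOL-Combinatorics.Multiset_Permutations"
    "HOL-Computational_Algebra.Formal_Power_Series"
begin

text \<open>
  A generalized pattern is represented by the list of its maximal dash-free segments, so that
  \<open>2-41-3\<close> is \<open>[[2], [4, 1], [3]]\<close>, the empty pattern is \<open>[]\<close>, and joining two patterns
  by a dash is list concatenation (a dash next to an empty pattern disappears).
\<close>
type_synonym gpattern = "nat list list"

abbreviation letters :: "gpattern \<Rightarrow> nat list" where
  "letters \<tau> \<equiv> concat \<tau>"

definition gen_pattern :: "gpattern \<Rightarrow> bool" where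
  "gen_pattern \<tau> \<longleftrightarrow> [] \<notin> set \<tau> \<and> distinct (letters \<tau>) \<and> (\<forall>a\<in>set (letters \<tau>). 0 < a)"

text \<open>Positions are counted from 0: there is a dash between the letters at positions \<open>j\<close> and \<open>j + 1\<close>.\<close>
definition dash_after :: "gpattern \<Rightarrow> nat \<Rightarrow> bool" where
  "dash_after \<tau> j \<longleftrightarrow> (\<exists>b<length \<tau>. length (letters (take b \<tau>)) = Suc j)"

definition order_isomorphic :: "nat list \<Rightarrow> nat list \<Rightarrow> bool" where
  "order_isomorphic xs ys \<longleftrightarrow> length xs = length ys \<and>
     (\<forall>i<length xs. \<forall>j<length xs. xs ! i < xs ! j \<longleftrightarrow> ys ! i < ys ! j)"

definition contains :: "nat list \<Rightarrow> gpattern \<Rightarrow> bool" where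
  "contains \<pi> \<tau> \<longleftrightarrow>
     (\<exists>is. sorted_wrt (<) is \<and> set is \<subseteq> {..<length \<pi>} \<and>
           order_isomorphic (map ((!) \<pi>) is) (letters \<tau>) \<and>
           (\<forall>j. Suc j < length is \<longrightarrow> \<not> dash_after \<tau> j \<longrightarrow> is ! Suc j = is ! j + 1))"

abbreviation avoids :: "nat list \<Rightarrow> gpattern \<Rightarrow> bool" where
  "avoids \<pi> \<tau> \<equiv> \<not> contains \<pi> \<tau>"

definition pattern_132 :: gpattern where
  "pattern_132 = [[1], [3], [2]]"

definition f_avoid :: "gpattern \<Rightarrow> nat \<Rightarrow> nat" where
  "f_avoid \<tau> n =
     card {\<pi> \<in> permutations_of_set {1..n}. avoids \<pi> pattern_132 \<and> avoids \<pi> \<tau>}"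

definition F_avoid :: "gpattern \<Rightarrow> rat fps" where
  "F_avoid \<tau> = Abs_fps (\<lambda>n. of_nat (f_avoid \<tau> n))"

end

theory Submission
  imports Defs
begin

text \<open>
  A nonempty permutation avoiding \<open>1-3-2\<close> has the form \<open>\<sigma> n \<rho>\<close>, where \<open>n\<close> is the maximum and every
  letter of \<open>\<sigma>\<close> exceeds every letter of \<open>\<rho>\<close>. If \<open>\<tau>\<close> avoids \<open>1-3-2\<close>, then the letters of \<open>\<tau>''\<close> are
  below \<open>d\<close>, and the only way in which an occurrence of \<open>\<tau>\<close> can meet both \<open>\<sigma>\<close> and \<open>\<rho>\<close> is that
  \<open>\<tau>'\<close> lies in \<open>\<sigma>\<close> and \<open>\<tau>''-d\<close> in \<open>\<rho>\<close>. Sorting by whether \<open>\<sigma>\<close> avoids \<open>\<tau>'\<close> gives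
  \<open>F\<^sub>\<tau> = 1 + x (F\<^sub>\<tau>\<^sub>' F\<^sub>\<tau> + (F\<^sub>\<tau> - F\<^sub>\<tau>\<^sub>') H)\<close>, where \<open>H\<close> belongs to \<open>\<tau>''-d\<close> and satisfies
  \<open>H = 1 + x F\<^sub>\<tau>\<^sub>'\<^sub>' H\<close>. If \<open>\<tau>'\<close> or \<open>\<tau>''\<close> contains \<open>1-3-2\<close>, then \<open>F\<^sub>\<tau>\<close> and \<open>F\<^sub>\<tau>\<^sub>'\<close>
  or \<open>F\<^sub>\<tau>\<^sub>'\<^sub>'\<close> equal the Catalan series \<open>C = 1 + x C\<^sup>2\<close>, which satisfies the same identity.
\<close>

section \<open>Occurrences as sequences of disjoint factors\<close>

text \<open>\<open>blocks_in ws xs\<close>: the words \<open>ws\<close> occur in \<open>xs\<close> as disjoint factors, in this order.\<close>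

inductive blocks_in :: "gpattern \<Rightarrow> nat list \<Rightarrow> bool" where
  Nil: "blocks_in [] xs"
| skip: "blocks_in ws xs \<Longrightarrow> blocks_in ws (x # xs)"
| block: "blocks_in ws xs \<Longrightarrow> blocks_in (w # ws) (w @ xs)"

lemma blocks_in_append_left: "blocks_in ws ys \<Longrightarrow> blocks_in ws (xs @ ys)"
  by (induction xs) (auto intro: blocks_in.skip)

lemma blocks_in_append:
  "blocks_in us xs \<Longrightarrow> blocks_in vs ys \<Longrightarrow> blocks_in (us @ vs) (xs @ ys)"
  by (induction us xs rule: blocks_in.induct)
     (auto intro: blocks_in_append_left blocks_in.skip dest: blocks_in.block)

lemma blocks_in_prefix: "blocks_in (us @ vs) xs \<Longrightarrow> blocks_in us xs"
proof (induction "us @ vs" xs arbitrary: us rule: blocks_in.induct)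
  case (block ws xs w)
  then show ?case by (cases us) (auto intro: blocks_in.intros)
qed (auto intro: blocks_in.intros)

lemma blocks_in_suffix: "blocks_in (us @ vs) xs \<Longrightarrow> blocks_in vs xs"
proof (induction "us @ vs" xs arbitrary: us rule: blocks_in.induct)
  case (block ws xs w)
  then show ?case
    by (cases us) (auto intro: blocks_in.block blocks_in_append_left)
qed (auto intro: blocks_in.intros)

lemma blocks_in_subset: "blocks_in ws xs \<Longrightarrow> set (concat ws) \<subseteq> set xs"
  by (induction rule: blocks_in.induct) auto

text \<open>Cutting at \<open>n\<close> breaks no block, because by hypothesis only the one-letter
  block \<open>[n]\<close> can cover that position. The two alternatives record whether the
  displayed \<open>n\<close> is passed over or used.\<close>

lemma blocks_in_split:
  assumes "blocks_in ws (\<sigma> @ n # \<rho>)" and "\<forall>w\<in>set ws. n \<in> set w \<longrightarrow> w = [n]"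
  shows "\<exists>us vs. blocks_in us \<sigma> \<and> blocks_in vs \<rho> \<and> (ws = us @ vs \<or> ws = us @ [n] # vs)"
  using assms
proof (induction ws "\<sigma> @ n # \<rho>" arbitrary: \<sigma> rule: blocks_in.induct)
  case Nil
  then show ?case by (auto intro: blocks_in.Nil)
next
  case (skip ws xs x)
  show ?case
  proof (cases \<sigma>)
    case Nil
    with skip have "blocks_in ws \<rho>" by simp
    with Nil show ?thesis by (auto intro: blocks_in.Nil)
  next
    case (Cons a \<sigma>')
    with skip.hyps(3) have "xs = \<sigma>' @ n # \<rho>" by simp
    from skip.hyps(2)[OF this skip.prems] Cons show ?thesis
      by (auto intro: blocks_in.skip)
  qed
next
  case (block ws xs w)
  \<comment> \<open>The first block either ends before the displayed \<open>n\<close> or reaches it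
    and hence contains that letter. The cases overlap, since \<open>\<sigma>\<close> may contain
    \<open>n\<close> too.\<close>
  consider (left) \<sigma>' where "\<sigma> = w @ \<sigma>'" "xs = \<sigma>' @ n # \<rho>"
    | (over) "n \<in> set w"
    using block.hyps(3) by (auto simp: append_eq_append_conv2 append_eq_Cons_conv Cons_eq_append_conv)
  then show ?case
  proof cases
    case left
    have "\<forall>w\<in>set ws. n \<in> set w \<longrightarrow> w = [n]" using block.prems by simp
    from block.hyps(2)[OF left(2) this] obtain us vs where
      "blocks_in us \<sigma>'" "blocks_in vs \<rho>" "ws = us @ vs \<or> ws = us @ [n] # vs" by blast
    then show ?thesis unfolding left(1)
      by (intro exI[of _ "w # us"] exI[of _ vs]) (auto intro: blocks_in.block)
  next
    case over
    with block.prems have w: "w = [n]" by simp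
    show ?thesis
    proof (cases \<sigma>)
      case Nil
      with w block.hyps show ?thesis by (auto intro: blocks_in.Nil)
    next
      \<comment> \<open>Here the block \<open>[n]\<close> is the first letter of
        \<open>\<sigma>\<close>, so the cut lies further right and the induction hypothesis applies
        to the rest.\<close>
      case (Cons a \<sigma>')
      with w block.hyps have "a = n" "xs = \<sigma>' @ n # \<rho>" by auto
      have "\<forall>w\<in>set ws. n \<in> set w \<longrightarrow> w = [n]" using block.prems by simp
      from block.hyps(2)[OF \<open>xs = _\<close> this] obtain us vs where
        "blocks_in us \<sigma>'" "blocks_in vs \<rho>" "ws = us @ vs \<or> ws = us @ [n] # vs" by blast
      moreover have "blocks_in ([n] # us) ([n] @ \<sigma>')"
        using \<open>blocks_in us \<sigma>'\<close> by (rule blocks_in.block)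
      ultimately show ?thesis unfolding w Cons \<open>a = n\<close>
        by (intro exI[of _ "[n] # us"] exI[of _ vs]) auto
    qed
  qed
qed

section \<open>Order isomorphism and concatenation\<close>

lemma order_isomorphic_iff_zip:
  "order_isomorphic xs ys \<longleftrightarrow> length xs = length ys \<and>
     (\<forall>(x, y)\<in>set (zip xs ys). \<forall>(x', y')\<in>set (zip xs ys). x < x' \<longleftrightarrow> y < y')"
  by (fastforce simp: order_isomorphic_def set_zip)

text \<open>Quantifying over zipped pairs instead of indices turns concatenation into a union of
  sets. The comparisons then fall into two inner families and two mixed ones, the latter merged into
  the last conjunct.\<close>

lemma order_isomorphic_append_iff:
  assumes "length xs = length ys"
  shows "order_isomorphic (xs @ xs') (ys @ ys') \<longleftrightarrow>
    order_isomorphic xs ys \<and> order_isomorphic xs' ys' \<and>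
    (\<forall>(x, y)\<in>set (zip xs ys). \<forall>(x', y')\<in>set (zip xs' ys').
       (x < x' \<longleftrightarrow> y < y') \<and> (x' < x \<longleftrightarrow> y' < y))"
proof -
  have "set (zip (xs @ xs') (ys @ ys')) = set (zip xs ys) \<union> set (zip xs' ys')"
    using assms by simp
  then show ?thesis
    using assms unfolding order_isomorphic_iff_zip case_prod_unfold by (simp add: ball_Un) blast
qed

lemma order_isomorphic_map_strict_mono:
  assumes "strict_mono (f :: nat \<Rightarrow> nat)"
  shows "order_isomorphic (map f xs) ys \<longleftrightarrow> order_isomorphic xs ys"
  using assms by (auto simp: order_isomorphic_def strict_mono_less)

section \<open>Dashes and positions\<close>

lemma dash_after_Cons_less: "Suc j < length w \<Longrightarrow> \<not> dash_after (w # \<tau>) j"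
  unfolding dash_after_def by (auto simp: take_Cons' split: if_splits)

lemma dash_after_Cons_shift:
  assumes "w \<noteq> []"
  shows "dash_after (w # \<tau>) (length w + j) \<longleftrightarrow> dash_after \<tau> j"
proof
  assume "dash_after (w # \<tau>) (length w + j)"
  then obtain b where b: "b < Suc (length \<tau>)"
    "length (letters (take b (w # \<tau>))) = Suc (length w + j)"
    unfolding dash_after_def by auto
  with assms show "dash_after \<tau> j" unfolding dash_after_def by (cases b) auto
next
  assume "dash_after \<tau> j"
  then obtain b where "b < length \<tau>" "length (letters (take b \<tau>)) = Suc j"
    unfolding dash_after_def by auto
  then show "dash_after (w # \<tau>) (length w + j)"
    unfolding dash_after_def by (intro exI[of _ "Suc b"]) auto
qed

text \<open>The cut is at \<open>b = 1\<close>, which \<open>dash_after\<close> admits only if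
  another segment follows: no dash stands behind the last letter of a pattern.\<close>

lemma dash_after_Cons_end:
  assumes "w \<noteq> []" "\<tau> \<noteq> []"
  shows "dash_after (w # \<tau>) (length w - 1)"
  unfolding dash_after_def using assms by (intro exI[of _ 1]) (auto simp: Suc_diff_1)

text \<open>The adjacency clause of \<open>contains\<close>, isolated so that it can be peeled off
  segment by segment.\<close>

definition segments_adjacent :: "gpattern \<Rightarrow> nat list \<Rightarrow> bool" where
  "segments_adjacent \<tau> ps \<longleftrightarrow>
     (\<forall>j. Suc j < length ps \<longrightarrow> \<not> dash_after \<tau> j \<longrightarrow> ps ! Suc j = ps ! j + 1)"

text \<open>Inside \<open>w\<close> there is no dash, so \<open>ps\<close> is forced to be an
  interval. Between \<open>w\<close> and a following segment there is one, so nothing links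
  \<open>ps\<close> to \<open>js\<close>.\<close>

lemma segments_adjacent_Cons:
  assumes "w \<noteq> []" "length ps = length w" "length js = length (letters \<tau>)" "[] \<notin> set \<tau>"
  shows "segments_adjacent (w # \<tau>) (ps @ js) \<longleftrightarrow>
    ps = [hd ps..<hd ps + length w] \<and> segments_adjacent \<tau> js"
proof -
  have ne: "ps \<noteq> []" using assms by auto
  have "segments_adjacent (w # \<tau>) (ps @ js) \<longleftrightarrow>
    (\<forall>j. Suc j < length w \<longrightarrow> ps ! Suc j = ps ! j + 1) \<and> segments_adjacent \<tau> js" (is "?L \<longleftrightarrow> ?R")
  proof
    assume L: ?L
    have "ps ! Suc j = ps ! j + 1" if "Suc j < length w" for j
      using L[unfolded segments_adjacent_def, rule_format, of j] that assms(2)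
        dash_after_Cons_less[OF that] by (auto simp: nth_append)
    moreover have "js ! Suc j = js ! j + 1" if "Suc j < length js" "\<not> dash_after \<tau> j" for j
      using L[unfolded segments_adjacent_def, rule_format, of "length w + j"] that assms(2)
      by (auto simp: nth_append dash_after_Cons_shift[OF assms(1)])
    ultimately show ?R by (auto simp: segments_adjacent_def)
  next
    assume R: ?R
    show ?L unfolding segments_adjacent_def
    proof (intro allI impI)
      fix j assume j: "Suc j < length (ps @ js)" "\<not> dash_after (w # \<tau>) j"
      consider "Suc j < length w" | "Suc j = length w" | "length w \<le> j" by linarith
      then show "(ps @ js) ! Suc j = (ps @ js) ! j + 1"
      proof cases
        case 1
        with R assms(2) show ?thesis by (auto simp: nth_append)
      next
        case 2
        then have "j = length w - 1" by simp
        moreover from 2 j(1) assms(2,3) have "\<tau> \<noteq> []" by auto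
        ultimately show ?thesis using dash_after_Cons_end[OF assms(1)] j(2) by auto
      next
        case 3
        then obtain i where i: "j = length w + i" using le_Suc_ex by blast
        with j assms(2) R show ?thesis
          by (auto simp: nth_append dash_after_Cons_shift[OF assms(1)] segments_adjacent_def)
      qed
    qed
  qed
  moreover have "(\<forall>j. Suc j < length w \<longrightarrow> ps ! Suc j = ps ! j + 1) \<longleftrightarrow>
    ps = [hd ps..<hd ps + length w]" (is "?L \<longleftrightarrow> ?R")
  proof
    assume L: ?L
    have "ps ! j = hd ps + j" if "j < length w" for j
      using that by (induction j) (use L ne in \<open>auto simp: hd_conv_nth\<close>)
    with assms(2) show ?R by (auto intro: nth_equalityI)
  next
    assume ?R
    then have "ps ! j = hd ps + j" if "j < length w" for j using that by (metis nth_upt add_less_cancel_left)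
    then show ?L by auto
  qed
  ultimately show ?thesis by blast
qed

lemma blocks_in_drop_mono:
  assumes "blocks_in ws (drop q xs)" "p \<le> q"
  shows "blocks_in ws (drop p xs)"
proof -
  have "drop p xs = take (q - p) (drop p xs) @ drop q xs"
    using append_take_drop_id[of "q - p" "drop p xs"] assms(2) by simp
  with assms(1) show ?thesis by (metis blocks_in_append_left)
qed

text \<open>Induction along the segments. The lower bound \<open>p\<close> on the positions is
  generalized so that the remaining segments can be sought in the part of \<open>xs\<close> behind
  the block just found.\<close>

lemma blocks_in_if_positions:
  assumes "[] \<notin> set \<tau>" "sorted_wrt (<) ps" "set ps \<subseteq> {p..<length xs}"
    "length ps = length (letters \<tau>)" "segments_adjacent \<tau> ps"
  shows "\<exists>ws. blocks_in ws (drop p xs) \<and> map length ws = map length \<tau> \<and> concat ws = map ((!) xs) ps"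
  using assms
proof (induction \<tau> arbitrary: ps p)
  case Nil
  then show ?case by (auto intro: blocks_in.Nil)
next
  case (Cons w \<tau>)
  define as bs where "as = take (length w) ps" and "bs = drop (length w) ps"
  have ps_eq: "ps = as @ bs" by (simp add: as_def bs_def)
  have len: "length as = length w" "length bs = length (letters \<tau>)"
    using Cons.prems(4) by (auto simp: as_def bs_def)
  have w: "w \<noteq> []" "[] \<notin> set \<tau>" using Cons.prems(1) by auto
  obtain a where as: "as = [a..<a + length w]" and adj: "segments_adjacent \<tau> bs"
    using Cons.prems(5) unfolding ps_eq segments_adjacent_Cons[OF w(1) len w(2)] by blast
  have a: "p \<le> a" "a + length w \<le> length xs"
  proof -
    have "a \<in> set as" "a + length w - 1 \<in> set as" using w(1) by (cases w; simp add: as)+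
    with Cons.prems(3) have "p \<le> a" "a + length w - 1 < length xs" unfolding ps_eq by auto
    with w(1) show "p \<le> a" "a + length w \<le> length xs" by (auto simp: Suc_le_eq less_diff_conv)
  qed
  \<comment> \<open>The last position of the first block is below all later positions, so these
    start at \<open>a + length w\<close> or beyond.\<close>
  have "a + length w - 1 \<in> set as" using w(1) by (cases w; simp add: as)+
  then have "\<forall>b\<in>set bs. a + length w - 1 < b" using Cons.prems(2)
    unfolding ps_eq sorted_wrt_append by blast
  then have "set bs \<subseteq> {a + length w..<length xs}" using Cons.prems(3) unfolding ps_eq by fastforce
  moreover have "sorted_wrt (<) bs" using Cons.prems(2) unfolding ps_eq sorted_wrt_append by blast
  ultimately obtain ws where ws: "blocks_in ws (drop (a + length w) xs)"
    "map length ws = map length \<tau>" "concat ws = map ((!) xs) bs"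
    using Cons.IH[OF w(2) _ _ len(2) adj] by blast
  have eq: "map ((!) xs) as = take (length w) (drop a xs)"
    using a(2) by (auto simp: as intro!: nth_equalityI)
  have "drop a xs = map ((!) xs) as @ drop (a + length w) xs"
    unfolding eq using append_take_drop_id[of "length w" "drop a xs"] by (simp add: add.commute)
  then have "blocks_in (map ((!) xs) as # ws) (drop a xs)"
    using blocks_in.block[OF ws(1)] by metis
  then have "blocks_in (map ((!) xs) as # ws) (drop p xs)" using a(1) by (rule blocks_in_drop_mono)
  with ws len show ?case by (intro exI[of _ "map ((!) xs) as # ws"]) (auto simp: ps_eq)
qed

text \<open>Positions are rebuilt along the derivation of \<open>blocks_in\<close>: a skipped letter
  shifts those found so far by one; a block shifts them by its length and puts an initial interval
  in front.\<close>

lemma positions_if_blocks_in: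
  assumes "blocks_in ws xs" "[] \<notin> set \<tau>" "map length ws = map length \<tau>"
  shows "\<exists>ps. sorted_wrt (<) ps \<and> set ps \<subseteq> {..<length xs} \<and> segments_adjacent \<tau> ps \<and>
    concat ws = map ((!) xs) ps"
  using assms
proof (induction ws xs arbitrary: \<tau> rule: blocks_in.induct)
  case (Nil xs)
  then show ?case by (auto simp: segments_adjacent_def)
next
  case (skip ws xs x)
  then obtain ps where ps: "sorted_wrt (<) ps" "set ps \<subseteq> {..<length xs}"
    "segments_adjacent \<tau> ps" "concat ws = map ((!) xs) ps" by blast
  then show ?case
    by (intro exI[of _ "map Suc ps"]) (auto simp: segments_adjacent_def sorted_wrt_map)
next
  case (block ws xs w)
  then obtain v \<tau>2 where \<tau>: "\<tau> = v # \<tau>2" by (cases \<tau>) auto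
  with block have v: "v \<noteq> []" "[] \<notin> set \<tau>2" "length w = length v" "map length ws = map length \<tau>2"
    by auto
  from block.IH[OF v(2,4)] obtain ps where ps: "sorted_wrt (<) ps" "set ps \<subseteq> {..<length xs}"
    "segments_adjacent \<tau>2 ps" "concat ws = map ((!) xs) ps" by blast
  define js where "js = map (\<lambda>i. i + length w) ps"
  have "length js = length (letters \<tau>2)"
    using arg_cong[OF ps(4), of length] v(4) by (simp add: js_def length_concat)
  moreover have "segments_adjacent \<tau>2 js" using ps(3) by (auto simp: segments_adjacent_def js_def)
  ultimately have "segments_adjacent \<tau> ([0..<length w] @ js)"
    unfolding \<tau> using v by (subst segments_adjacent_Cons) (auto simp: hd_conv_nth)
  moreover have "sorted_wrt (<) ([0..<length w] @ js)"
    using ps(1) by (auto simp: js_def sorted_wrt_append sorted_wrt_map)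
  moreover have "set ([0..<length w] @ js) \<subseteq> {..<length (w @ xs)}"
    using ps(2) by (auto simp: js_def)
  moreover have "concat (w # ws) = map ((!) (w @ xs)) ([0..<length w] @ js)"
    by (auto simp: js_def ps(4) nth_append intro!: nth_equalityI)
  ultimately show ?case by blast
qed

text \<open>Replaces index sequences by words that can be cut and concatenated, the form in which
  occurrences are handled around the maximum.\<close>

lemma contains_iff_blocks_in:
  assumes "[] \<notin> set \<tau>"
  shows "contains \<pi> \<tau> \<longleftrightarrow> (\<exists>ws. blocks_in ws \<pi> \<and> map length ws = map length \<tau> \<and>
    order_isomorphic (concat ws) (letters \<tau>))"
proof
  assume "contains \<pi> \<tau>"
  then obtain ps where ps: "sorted_wrt (<) ps" "set ps \<subseteq> {0..<length \<pi>}"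
    "order_isomorphic (map ((!) \<pi>) ps) (letters \<tau>)" "segments_adjacent \<tau> ps"
    unfolding contains_def segments_adjacent_def lessThan_atLeast0 by blast
  then have "length ps = length (letters \<tau>)" by (simp add: order_isomorphic_def)
  from blocks_in_if_positions[OF assms ps(1,2) this ps(4)] ps(3)
  show "\<exists>ws. blocks_in ws \<pi> \<and> map length ws = map length \<tau> \<and>
    order_isomorphic (concat ws) (letters \<tau>)" by fastforce
next
  assume "\<exists>ws. blocks_in ws \<pi> \<and> map length ws = map length \<tau> \<and>
    order_isomorphic (concat ws) (letters \<tau>)"
  then show "contains \<pi> \<tau>"
    using positions_if_blocks_in[OF _ assms]
    unfolding contains_def segments_adjacent_def by metis
qed


section \<open>Subpatterns and monotone relabelling\<close>

lemma contains_append_left: "[] \<notin> set (\<alpha> @ \<beta>) \<Longrightarrow> contains \<pi> (\<alpha> @ \<beta>) \<Longrightarrow> contains \<pi> \<alpha>"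
proof -
  assume ne: "[] \<notin> set (\<alpha> @ \<beta>)" and "contains \<pi> (\<alpha> @ \<beta>)"
  then obtain ws where ws: "blocks_in ws \<pi>" "map length ws = map length (\<alpha> @ \<beta>)"
    "order_isomorphic (concat ws) (letters (\<alpha> @ \<beta>))"
    by (auto simp: contains_iff_blocks_in[OF ne])
  then obtain us vs where uv: "ws = us @ vs" "map length us = map length \<alpha>"
    by (auto simp: map_eq_append_conv)
  then have "length (concat us) = length (letters \<alpha>)" by (simp add: length_concat)
  then have "order_isomorphic (concat us) (letters \<alpha>)"
    using ws(3) by (simp add: uv(1) order_isomorphic_append_iff)
  with uv ws(1) ne show "contains \<pi> \<alpha>"
    by (auto simp: contains_iff_blocks_in intro: blocks_in_prefix)
qed

lemma contains_append_right: "[] \<notin> set (\<alpha> @ \<beta>) \<Longrightarrow> contains \<pi> (\<alpha> @ \<beta>) \<Longrightarrow> contains \<pi> \<beta>"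
proof -
  assume ne: "[] \<notin> set (\<alpha> @ \<beta>)" and "contains \<pi> (\<alpha> @ \<beta>)"
  then obtain ws where ws: "blocks_in ws \<pi>" "map length ws = map length (\<alpha> @ \<beta>)"
    "order_isomorphic (concat ws) (letters (\<alpha> @ \<beta>))"
    by (auto simp: contains_iff_blocks_in[OF ne])
  then obtain us vs where uv: "ws = us @ vs" "map length us = map length \<alpha>"
    "map length vs = map length \<beta>"
    by (auto simp: map_eq_append_conv)
  then have "length (concat us) = length (letters \<alpha>)" by (simp add: length_concat)
  then have "order_isomorphic (concat vs) (letters \<beta>)"
    using ws(3) by (simp add: uv(1) order_isomorphic_append_iff)
  with uv ws(1) ne show "contains \<pi> \<beta>"
    by (auto simp: contains_iff_blocks_in intro: blocks_in_suffix)
qed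

lemma contains_empty_pattern: "contains \<pi> []"
  by (simp add: contains_iff_blocks_in order_isomorphic_def blocks_in.Nil)

lemma contains_empty_list: "contains [] \<tau> \<Longrightarrow> letters \<tau> = []"
  by (auto simp: contains_def order_isomorphic_def)

text \<open>Used for shifts: in \<open>\<sigma> n \<rho>\<close> the word \<open>\<sigma>\<close> is
  a permutation raised by the length of \<open>\<rho>\<close>.\<close>

lemma contains_map_strict_mono:
  assumes "strict_mono f"
  shows "contains (map f \<pi>) \<tau> \<longleftrightarrow> contains \<pi> \<tau>"
proof -
  have "map ((!) (map f \<pi>)) ps = map f (map ((!) \<pi>) ps)" if "set ps \<subseteq> {..<length \<pi>}" for ps
    using that by (auto simp: subset_iff)
  then show ?thesis unfolding contains_def
    using order_isomorphic_map_strict_mono[OF assms] by (metis length_map)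
qed

section \<open>Occurrences around the maximum\<close>

definition exceeds :: "nat list \<Rightarrow> nat list \<Rightarrow> bool" where
  "exceeds xs ys \<longleftrightarrow> (\<forall>x\<in>set xs. \<forall>y\<in>set ys. y < x)"

text \<open>All mixed comparisons go one way once \<open>xs\<close> exceeds \<open>xs'\<close>, so
  they amount to the same one-way condition on the pattern side.\<close>

lemma order_isomorphic_append_exceeds:
  assumes "length xs = length ys" "exceeds xs xs'"
  shows "order_isomorphic (xs @ xs') (ys @ ys') \<longleftrightarrow>
    order_isomorphic xs ys \<and> order_isomorphic xs' ys' \<and> exceeds ys ys'"
proof -
  \<comment> \<open>Equal lengths give every pattern letter a partner. Both sides of the claim
    supply them through \<open>order_isomorphic xs' ys'\<close>.\<close>
  have "(\<forall>(x, y)\<in>set (zip xs ys). \<forall>(x', y')\<in>set (zip xs' ys').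
       (x < x' \<longleftrightarrow> y < y') \<and> (x' < x \<longleftrightarrow> y' < y)) \<longleftrightarrow> exceeds ys ys'" (is "?L \<longleftrightarrow> ?R")
    if len: "length xs' = length ys'"
  proof
    assume L: ?L
    show ?R unfolding exceeds_def
    proof (intro ballI)
      fix y y' assume "y \<in> set ys" "y' \<in> set ys'"
      then obtain x x' where xx: "(x, y) \<in> set (zip xs ys)" "(x', y') \<in> set (zip xs' ys')"
        using assms(1) len by (metis in_set_impl_in_set_zip2)
      then have "x' < x" using assms(2) by (auto simp: exceeds_def dest: set_zip_leftD)
      with L xx show "y' < y" by blast
    qed
  next
    assume R: ?R
    have "x' < x \<and> y' < y" if "(x, y) \<in> set (zip xs ys)" "(x', y') \<in> set (zip xs' ys')" for x y x' y'
      using assms(2) R set_zip_leftD[OF that(1)] set_zip_leftD[OF that(2)]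
        set_zip_rightD[OF that(1)] set_zip_rightD[OF that(2)] by (auto simp: exceeds_def)
    then show ?L by fastforce
  qed
  moreover have "length xs' = length ys'" if "order_isomorphic xs' ys'"
    using that by (simp add: order_isomorphic_def)
  ultimately show ?thesis unfolding order_isomorphic_append_iff[OF assms(1)] by blast
qed

text \<open>The only new pair is \<open>(n, m)\<close>. As \<open>m\<close> lies above all other
  pattern letters, its comparisons are respected exactly if \<open>n\<close> lies above all other
  letters of the word.\<close>

lemma order_isomorphic_insert_max:
  assumes "length xs = length ys" "\<forall>y\<in>set (ys @ ys'). y < m"
  shows "order_isomorphic (xs @ n # xs') (ys @ m # ys') \<longleftrightarrow>
    order_isomorphic (xs @ xs') (ys @ ys') \<and> (\<forall>x\<in>set (xs @ xs'). x < n)"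
proof (cases "length xs' = length ys'")
  case False
  with assms show ?thesis by (auto simp: order_isomorphic_def)
next
  case True
  define Z where "Z = set (zip (xs @ xs') (ys @ ys'))"
  have zip_eq: "set (zip (xs @ n # xs') (ys @ m # ys')) = insert (n, m) Z"
    using assms(1) by (auto simp: Z_def)
  have y: "y < m" if "(x, y) \<in> Z" for x y
    using that assms(2) unfolding Z_def by (metis set_zip_rightD)
  have ex: "(\<forall>x\<in>set (xs @ xs'). x < n) \<longleftrightarrow> (\<forall>(x, y)\<in>Z. x < n)"
    using assms(1) True unfolding Z_def
    by (metis (no_types, lifting) case_prodD case_prodI2 in_set_impl_in_set_zip1 length_append set_zip_leftD)
  have "(\<forall>(x, y)\<in>insert (n, m) Z. \<forall>(x', y')\<in>insert (n, m) Z. x < x' \<longleftrightarrow> y < y') \<longleftrightarrow>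
    (\<forall>(x, y)\<in>Z. \<forall>(x', y')\<in>Z. x < x' \<longleftrightarrow> y < y') \<and> (\<forall>(x, y)\<in>Z. x < n)" (is "?L \<longleftrightarrow> ?R")
  proof
    assume ?L
    with y show ?R unfolding case_prod_unfold by (simp, metis prod.collapse)
  next
    assume R: ?R
    then have "\<forall>p\<in>Z. fst p < n \<and> \<not> n < fst p \<and> snd p < m \<and> \<not> m < snd p"
      using y by (auto simp: not_less less_imp_le)
    with R show ?L unfolding case_prod_unfold by simp
  qed
  then show ?thesis
    unfolding order_isomorphic_iff_zip zip_eq ex Z_def[symmetric] using assms(1) True by auto
qed

lemma exceeds_subset:
  "exceeds xs ys \<Longrightarrow> set us \<subseteq> set xs \<Longrightarrow> set vs \<subseteq> set ys \<Longrightarrow> exceeds us vs"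
  by (auto simp: exceeds_def)

text \<open>An occurrence in \<open>\<sigma> n \<rho>\<close> either uses the maximum \<open>n\<close>, which then plays the maximal letter
  of the pattern, or is cut by \<open>n\<close> between two segments.\<close>
lemma contains_around_max_iff:
  assumes ne: "[] \<notin> set (\<tau>1 @ [m] # \<tau>2)"
    and m: "\<forall>a\<in>set (letters (\<tau>1 @ \<tau>2)). a < m"
    and n: "\<forall>a\<in>set (\<sigma> @ \<rho>). a < n"
    and ex: "exceeds \<sigma> \<rho>"
  shows "contains (\<sigma> @ n # \<rho>) (\<tau>1 @ [m] # \<tau>2) \<longleftrightarrow>
    (\<exists>\<alpha> \<beta>. \<tau>1 @ [m] # \<tau>2 = \<alpha> @ \<beta> \<and> exceeds (letters \<alpha>) (letters \<beta>) \<and>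
       contains \<sigma> \<alpha> \<and> contains \<rho> \<beta>) \<or>
    (exceeds (letters \<tau>1) (letters \<tau>2) \<and> contains \<sigma> \<tau>1 \<and> contains \<rho> \<tau>2)"
    (is "?L \<longleftrightarrow> ?cut \<or> ?max")
proof
  assume ?L
  then obtain ws where ws: "blocks_in ws (\<sigma> @ n # \<rho>)"
    "map length ws = map length (\<tau>1 @ [m] # \<tau>2)"
    "order_isomorphic (concat ws) (letters (\<tau>1 @ [m] # \<tau>2))"
    unfolding contains_iff_blocks_in[OF ne] by blast
  from ws(2) obtain us w vs where "ws = us @ w # vs" "map length us = map length \<tau>1"
    "length w = Suc 0" "map length vs = map length \<tau>2"
    by (auto simp: map_eq_append_conv map_eq_Cons_conv)
  then obtain x where uv: "ws = us @ [x] # vs" "map length us = map length \<tau>1"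
    "map length vs = map length \<tau>2"
    by (auto simp: length_Suc_conv)
  have len: "length (concat us) = length (letters \<tau>1)" using uv(2) by (simp add: length_concat)
  have oi: "order_isomorphic (concat us @ concat vs) (letters \<tau>1 @ letters \<tau>2)"
    and less: "\<forall>y\<in>set (concat us @ concat vs). y < x"
    using ws(3) m by (auto simp: uv(1) order_isomorphic_insert_max[OF len])
  have "set (concat ws) \<subseteq> set (\<sigma> @ n # \<rho>)" using blocks_in_subset[OF ws(1)] .
  then have "x \<in> set (\<sigma> @ n # \<rho>)" by (auto simp: uv(1))
  then have "x \<le> n" using n by (auto simp: less_imp_le)
  \<comment> \<open>The letter \<open>x\<close> plays \<open>m\<close> and all others lie strictly
    below it, so only the block \<open>[x]\<close> can use the maximum \<open>n\<close>.\<close>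
  then have n_notin: "n \<notin> set (concat us @ concat vs)" using less leD by blast
  then have "\<forall>w\<in>set ws. n \<in> set w \<longrightarrow> w = [n]" by (auto simp: uv(1))
  then obtain as bs where ab: "blocks_in as \<sigma>" "blocks_in bs \<rho>" "ws = as @ bs \<or> ws = as @ [n] # bs"
    using blocks_in_split[OF ws(1)] by blast
  have sub: "set (concat as) \<subseteq> set \<sigma>" "set (concat bs) \<subseteq> set \<rho>"
    using ab blocks_in_subset by blast+
  have ex': "exceeds (concat as) (concat bs)" by (rule exceeds_subset[OF ex sub])
  from ab(3) show "?cut \<or> ?max"
  proof
    \<comment> \<open>The occurrence misses \<open>n\<close>, and the cut of the word induces a cut
      of the pattern between two segments.\<close>
    assume eq: "ws = as @ bs"
    then have "map length (\<tau>1 @ [m] # \<tau>2) = map length as @ map length bs"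
      using ws(2) by (metis map_append)
    then obtain \<alpha> \<beta> where \<alpha>\<beta>: "\<tau>1 @ [m] # \<tau>2 = \<alpha> @ \<beta>" "map length as = map length \<alpha>"
      "map length bs = map length \<beta>"
      unfolding map_eq_append_conv by metis
    have l: "length (concat as) = length (letters \<alpha>)" using \<alpha>\<beta>(2) by (simp add: length_concat)
    have "order_isomorphic (concat as @ concat bs) (letters \<alpha> @ letters \<beta>)"
      using ws(3) unfolding \<alpha>\<beta>(1) eq by simp
    moreover have "[] \<notin> set \<alpha>" "[] \<notin> set \<beta>" using ne unfolding \<alpha>\<beta>(1) by auto
    ultimately have "contains \<sigma> \<alpha>" "contains \<rho> \<beta>" "exceeds (letters \<alpha>) (letters \<beta>)"
      using ab(1,2) \<alpha>\<beta>(2,3)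
      by (auto simp: order_isomorphic_append_exceeds[OF l ex'] contains_iff_blocks_in)
    with \<alpha>\<beta>(1) show ?thesis by blast
  next
    assume eq: "ws = as @ [n] # bs"
    \<comment> \<open>The block \<open>[n]\<close> occurs only once in \<open>ws\<close>, so both
      descriptions of \<open>ws\<close> are split at the same place.\<close>
    have "[n] \<notin> set us" "[n] \<notin> set vs" using n_notin by auto
    moreover have "[n] \<notin> set as" "[n] \<notin> set bs" using n sub by fastforce+
    moreover have "[n] = [x]" using eq \<open>[n] \<notin> set us\<close> \<open>[n] \<notin> set vs\<close>
      by (metis uv(1) Un_iff in_set_conv_decomp set_ConsD set_append)
    ultimately have "as = us" "bs = vs" using eq uv(1)
      by (auto simp: append_Cons_eq_iff)
    then have "contains \<sigma> \<tau>1" "contains \<rho> \<tau>2" "exceeds (letters \<tau>1) (letters \<tau>2)"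
      using ab(1,2) oi uv(2,3) ne ex'
      by (auto simp: order_isomorphic_append_exceeds[OF len] contains_iff_blocks_in)
    then show ?thesis by blast
  qed
next
  assume "?cut \<or> ?max"
  then show ?L
  proof
    assume ?cut
    then obtain \<alpha> \<beta> where \<alpha>\<beta>: "\<tau>1 @ [m] # \<tau>2 = \<alpha> @ \<beta>" "exceeds (letters \<alpha>) (letters \<beta>)"
      "contains \<sigma> \<alpha>" "contains \<rho> \<beta>" by blast
    have "[] \<notin> set \<alpha>" "[] \<notin> set \<beta>" using ne unfolding \<alpha>\<beta>(1) by auto
    then obtain as bs where as: "blocks_in as \<sigma>" "map length as = map length \<alpha>"
      "order_isomorphic (concat as) (letters \<alpha>)" and bs: "blocks_in bs \<rho>"
      "map length bs = map length \<beta>" "order_isomorphic (concat bs) (letters \<beta>)"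
      using \<alpha>\<beta> by (auto simp: contains_iff_blocks_in)
    have "exceeds (concat as) (concat bs)" using exceeds_subset[OF ex] as bs blocks_in_subset by blast
    then have "order_isomorphic (concat (as @ bs)) (letters (\<alpha> @ \<beta>))"
      using as bs \<alpha>\<beta>(2) by (simp add: order_isomorphic_append_exceeds length_concat)
    moreover have "blocks_in (as @ bs) (\<sigma> @ n # \<rho>)"
      using as bs by (auto intro: blocks_in_append blocks_in.skip)
    ultimately show ?L unfolding contains_iff_blocks_in[OF ne] unfolding \<alpha>\<beta>(1) using as(2) bs(2)
      by (intro exI[of _ "as @ bs"]) simp
  next
    assume max: ?max
    obtain as bs where as: "blocks_in as \<sigma>" "map length as = map length \<tau>1"
      "order_isomorphic (concat as) (letters \<tau>1)" and bs: "blocks_in bs \<rho>"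
      "map length bs = map length \<tau>2" "order_isomorphic (concat bs) (letters \<tau>2)"
      using max ne by (auto simp: contains_iff_blocks_in)
    have sub: "set (concat as) \<subseteq> set \<sigma>" "set (concat bs) \<subseteq> set \<rho>"
      using as bs blocks_in_subset by blast+
    have len: "length (concat as) = length (letters \<tau>1)" using as by (simp add: length_concat)
    have "exceeds (concat as) (concat bs)" using exceeds_subset[OF ex sub] .
    then have "order_isomorphic (concat as @ concat bs) (letters \<tau>1 @ letters \<tau>2)"
      using as bs max by (simp add: order_isomorphic_append_exceeds len)
    moreover have "\<forall>y\<in>set (concat as @ concat bs). y < n" using n sub by (auto simp: subset_iff)
    ultimately have "order_isomorphic (concat (as @ [n] # bs)) (letters (\<tau>1 @ [m] # \<tau>2))"
      using m order_isomorphic_insert_max[OF len, of "letters \<tau>2" m n "concat bs"] by simp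
    moreover have "blocks_in (as @ [n] # bs) (\<sigma> @ [n] @ \<rho>)"
      using as bs by (intro blocks_in_append blocks_in.block)
    ultimately show ?L unfolding contains_iff_blocks_in[OF ne] using as bs
      by (intro exI[of _ "as @ [n] # bs"]) auto
  qed
qed

section \<open>The pattern 1-3-2\<close>

lemma contains_132_iff:
  "contains \<pi> pattern_132 \<longleftrightarrow>
    (\<exists>i j l. i < j \<and> j < l \<and> l < length \<pi> \<and> \<pi> ! i < \<pi> ! l \<and> \<pi> ! l < \<pi> ! j)" (is "?L \<longleftrightarrow> ?R")
proof
  assume ?L
  then obtain ps where ps: "sorted_wrt (<) ps" "set ps \<subseteq> {..<length \<pi>}"
    "order_isomorphic (map ((!) \<pi>) ps) [1, 3, 2]"
    unfolding contains_def pattern_132_def by auto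
  then have "length ps = Suc (Suc (Suc 0))" by (simp add: order_isomorphic_def)
  then obtain i j l where [simp]: "ps = [i, j, l]" by (auto simp: length_Suc_conv)
  \<comment> \<open>Positions 0, 1, 2 of the pattern carry the letters 1, 3, 2, so comparing
    positions 0 with 2 and 2 with 1 gives the two inequalities.\<close>
  have "\<pi> ! i < \<pi> ! l" "\<pi> ! l < \<pi> ! j"
    using ps(3)[unfolded order_isomorphic_def, THEN conjunct2, rule_format, of 0 2]
      ps(3)[unfolded order_isomorphic_def, THEN conjunct2, rule_format, of 2 1] by auto
  with ps show ?R by auto
next
  assume ?R
  then obtain i j l where ijl: "i < j" "j < l" "l < length \<pi>" "\<pi> ! i < \<pi> ! l" "\<pi> ! l < \<pi> ! j"
    by blast
  then have "order_isomorphic (map ((!) \<pi>) [i, j, l]) (letters pattern_132)"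
    by (auto simp: order_isomorphic_def pattern_132_def less_Suc_eq numeral_eq_Suc)
  \<comment> \<open>Every letter but the last is followed by a dash, so the adjacency clause is
    vacuous.\<close>
  moreover have "dash_after pattern_132 q" if "q < 2" for q
    using that unfolding dash_after_def pattern_132_def
    by (intro exI[of _ "Suc q"]) (auto simp: less_Suc_eq numeral_eq_Suc)
  ultimately show ?L using ijl unfolding contains_def
    by (intro exI[of _ "[i, j, l]"]) auto
qed

text \<open>Occurrences compose: positions in \<open>letters \<tau>\<close> are sent to positions in
  \<open>\<pi>\<close>, and 1-3-2 imposes no adjacency that could be lost on the way.\<close>

lemma contains_132_if_contains:
  assumes "contains \<pi> \<tau>" "contains (letters \<tau>) pattern_132"
  shows "contains \<pi> pattern_132"
proof -
  obtain ps where ps: "sorted_wrt (<) ps" "set ps \<subseteq> {..<length \<pi>}"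
    "order_isomorphic (map ((!) \<pi>) ps) (letters \<tau>)"
    using assms(1) unfolding contains_def by auto
  obtain i j l where ijl: "i < j" "j < l" "l < length (letters \<tau>)"
    "letters \<tau> ! i < letters \<tau> ! l" "letters \<tau> ! l < letters \<tau> ! j"
    using assms(2) unfolding contains_132_iff by blast
  have len: "length ps = length (letters \<tau>)" using ps(3) by (simp add: order_isomorphic_def)
  have "\<pi> ! (ps ! i) < \<pi> ! (ps ! l)" "\<pi> ! (ps ! l) < \<pi> ! (ps ! j)"
    using ps(3)[unfolded order_isomorphic_def, THEN conjunct2, rule_format, of i l]
      ps(3)[unfolded order_isomorphic_def, THEN conjunct2, rule_format, of l j] ijl len by auto
  moreover have "ps ! i < ps ! j" "ps ! j < ps ! l"
    using ps(1) ijl len by (auto intro: sorted_wrt_nth_less)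
  moreover have "ps ! l < length \<pi>" using ps(2) ijl(3) len by (metis lessThan_iff nth_mem subset_iff)
  ultimately show ?thesis unfolding contains_132_iff by blast
qed

text \<open>Letting \<open>n\<close> play the 3, or cutting the pattern into two nonempty parts,
  puts 1 on the left and 2 on the right, so 1 would have to exceed 2. Only occurrences inside one
  side survive.\<close>

lemma contains_132_around_max_iff:
  assumes "\<forall>a\<in>set (\<sigma> @ \<rho>). a < n" "exceeds \<sigma> \<rho>"
  shows "contains (\<sigma> @ n # \<rho>) pattern_132 \<longleftrightarrow> contains \<sigma> pattern_132 \<or> contains \<rho> pattern_132"
proof -
  have eq: "pattern_132 = [[1]] @ [3] # [[2]]" by (simp add: pattern_132_def)
  have "contains (\<sigma> @ n # \<rho>) pattern_132 \<longleftrightarrow>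
    (\<exists>\<alpha> \<beta>. pattern_132 = \<alpha> @ \<beta> \<and> exceeds (letters \<alpha>) (letters \<beta>) \<and> contains \<sigma> \<alpha> \<and> contains \<rho> \<beta>)"
    unfolding eq by (subst contains_around_max_iff[OF _ _ assms]) (auto simp: exceeds_def)
  also have "\<dots> \<longleftrightarrow> (\<exists>\<alpha> \<beta>. pattern_132 = \<alpha> @ \<beta> \<and> (\<alpha> = [] \<or> \<beta> = []) \<and> contains \<sigma> \<alpha> \<and> contains \<rho> \<beta>)"
    by (intro ex_cong1) (auto simp: pattern_132_def Cons_eq_append_conv exceeds_def)
  also have "\<dots> \<longleftrightarrow> contains \<sigma> pattern_132 \<or> contains \<rho> pattern_132"
    using contains_empty_pattern by (metis append.left_neutral append.right_neutral)
  finally show ?thesis .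
qed

text \<open>A letter \<open>x\<close> of \<open>\<sigma>\<close> below a letter \<open>y\<close> of
  \<open>\<rho>\<close> would give the occurrence \<open>x n y\<close>. This is applied both to
  permutations and to the letters of the pattern \<open>\<tau>\<close> itself.\<close>

lemma exceeds_if_avoids_132:
  assumes "distinct (\<sigma> @ n # \<rho>)" "\<forall>a\<in>set (\<sigma> @ \<rho>). a < n" "avoids (\<sigma> @ n # \<rho>) pattern_132"
  shows "exceeds \<sigma> \<rho>"
  unfolding exceeds_def
proof (intro ballI, rule ccontr)
  fix x y assume xy: "x \<in> set \<sigma>" "y \<in> set \<rho>" "\<not> y < x"
  then obtain i j where ij: "i < length \<sigma>" "\<sigma> ! i = x" "j < length \<rho>" "\<rho> ! j = y"
    by (auto simp: in_set_conv_nth)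
  have "x < y" using xy assms(1) by (auto simp: not_less le_less)
  with ij xy(2) assms(2) have "contains (\<sigma> @ n # \<rho>) pattern_132"
    unfolding contains_132_iff
    by (intro exI[of _ i] exI[of _ "length \<sigma>"] exI[of _ "Suc (length \<sigma> + j)"])
       (auto simp: nth_append)
  with assms(3) show False by simp
qed

section \<open>Counting by the position of the maximum\<close>

definition av132 :: "(nat list \<Rightarrow> bool) \<Rightarrow> nat \<Rightarrow> nat list set" where
  "av132 P n = {\<pi> \<in> permutations_of_set {1..n}. avoids \<pi> pattern_132 \<and> P \<pi>}"

definition av132_fps :: "(nat list \<Rightarrow> bool) \<Rightarrow> rat fps" where
  "av132_fps P = Abs_fps (\<lambda>n. of_nat (card (av132 P n)))"

lemma finite_av132: "finite (av132 P n)"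
  by (simp add: av132_def)

lemma F_avoid_eq_av132_fps: "F_avoid \<tau> = av132_fps (\<lambda>\<pi>. avoids \<pi> \<tau>)"
  by (simp add: F_avoid_def f_avoid_def av132_fps_def av132_def)

text \<open>Turns the class of permutations that avoid \<open>\<tau>\<close> but contain
  \<open>\<tau>'\<close> into a difference of series.\<close>

lemma av132_fps_diff:
  assumes "\<And>\<pi>. R \<pi> \<Longrightarrow> P \<pi>"
  shows "av132_fps (\<lambda>\<pi>. P \<pi> \<and> \<not> R \<pi>) = av132_fps P - av132_fps R"
proof (rule fps_ext)
  fix n
  have eq: "av132 (\<lambda>\<pi>. P \<pi> \<and> \<not> R \<pi>) n = av132 P n - av132 R n" and sub: "av132 R n \<subseteq> av132 P n"
    using assms by (auto simp: av132_def)
  show "fps_nth (av132_fps (\<lambda>\<pi>. P \<pi> \<and> \<not> R \<pi>)) n = fps_nth (av132_fps P - av132_fps R) n"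
    using card_Diff_subset[OF finite_av132 sub] card_mono[OF finite_av132 sub]
    unfolding av132_fps_def eq[symmetric] by (simp add: of_nat_diff)
qed

lemma av132_fps_False: "av132_fps (\<lambda>_. False) = 0"
  by (rule fps_ext) (simp add: av132_fps_def av132_def)

text \<open>A positive number below \<open>Max R\<close> lies in \<open>R\<close>, since a member of
  \<open>S\<close> would exceed \<open>Max R\<close>. So \<open>R\<close> is an initial interval and
  its size fixes both sets.\<close>

lemma down_closed_eq_atLeastAtMost:
  assumes "S \<union> R = {1..n}" "\<forall>x\<in>S. \<forall>y\<in>R. y < (x :: nat)"
  shows "R = {1..card R} \<and> S = {card R + 1..n}"
proof -
  have fin: "finite R" using assms(1) by (metis finite_Un finite_atLeastAtMost)
  have R: "R = {1..card R}"
  proof (cases "R = {}")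
    case False
    have "{1..Max R} \<subseteq> R"
    proof
      fix y assume y: "y \<in> {1..Max R}"
      have "Max R \<in> {1..n}" using Max_in[OF fin False] assms(1) by blast
      with y have "y \<in> S \<union> R" using assms(1) by auto
      with y assms(2) Max_in[OF fin False] show "y \<in> R" by fastforce
    qed
    moreover have "R \<subseteq> {1..Max R}" using assms(1) fin by auto
    ultimately have "R = {1..Max R}" by blast
    then show ?thesis by (metis card_atLeastAtMost diff_Suc_1)
  qed auto
  moreover have "S = {1..n} - R" using assms by blast
  moreover have "card R \<le> n" using card_mono[of "{1..n}" R] assms(1) by auto
  ultimately have "S = {1..n} - {1..card R}" by metis
  then have "S = {card R + 1..n}" by auto
  with R show ?thesis by blast
qed

lemma shift_strict_mono: "strict_mono (\<lambda>x::nat. x + c)"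
  by (simp add: strict_mono_def)

text \<open>The index \<open>i\<close> is the length of \<open>\<sigma>\<close>. Raising its letters
  by \<open>n - i\<close>, the length of \<open>\<rho>\<close>, puts them just above those of
  \<open>\<rho>\<close> and below \<open>Suc n\<close>. As \<open>Q\<close> ignores such a shift,
  \<open>P\<close> becomes a condition on two standard permutations.\<close>

lemma bij_betw_av132_Suc:
  assumes P: "\<And>\<sigma> m \<rho>. \<forall>a\<in>set (\<sigma> @ \<rho>). a < m \<Longrightarrow> exceeds \<sigma> \<rho> \<Longrightarrow> P (\<sigma> @ m # \<rho>) \<longleftrightarrow> Q \<sigma> \<rho>"
    and Q: "\<And>\<sigma> \<rho> c. Q (map (\<lambda>x. x + c) \<sigma>) \<rho> \<longleftrightarrow> Q \<sigma> \<rho>"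
  shows "bij_betw (\<lambda>(i, \<sigma>, \<rho>). map (\<lambda>x. x + (n - i)) \<sigma> @ Suc n # \<rho>)
    (SIGMA i:{..n}. {(\<sigma>, \<rho>) \<in> av132 (\<lambda>_. True) i \<times> av132 (\<lambda>_. True) (n - i). Q \<sigma> \<rho>})
    (av132 P (Suc n))" (is "bij_betw ?f ?A ?B")
  unfolding bij_betw_def
proof (intro conjI)
  have props: "i \<le> n" "set \<sigma> = {1..i}" "set \<rho> = {1..n - i}" "distinct \<sigma>" "distinct \<rho>"
    "avoids \<sigma> pattern_132" "avoids \<rho> pattern_132" "Q \<sigma> \<rho>" "length \<sigma> = i"
    if "(i, \<sigma>, \<rho>) \<in> ?A" for i \<sigma> \<rho>
    using that by (auto simp: av132_def permutations_of_set_def dest: distinct_card)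
  show "inj_on ?f ?A"
  proof (rule inj_onI)
    fix t t' assume t: "t \<in> ?A" "t' \<in> ?A" "?f t = ?f t'"
    obtain i \<sigma> \<rho> i' \<sigma>' \<rho>' where tt: "t = (i, \<sigma>, \<rho>)" "t' = (i', \<sigma>', \<rho>')"
      by (cases t, cases t')
    from t have A: "(i, \<sigma>, \<rho>) \<in> ?A" "(i', \<sigma>', \<rho>') \<in> ?A"
      and eq: "map (\<lambda>x. x + (n - i)) \<sigma> @ Suc n # \<rho> = map (\<lambda>x. x + (n - i')) \<sigma>' @ Suc n # \<rho>'"
      unfolding tt by simp_all
    note p = props[OF A(1)] and p' = props[OF A(2)]
    \<comment> \<open>The maximum occurs once and marks the same cut in both words. The lengths then
      give \<open>i = i'\<close>, and the shift can be undone.\<close>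
    have "Suc n \<notin> set (map (\<lambda>x. x + (n - i)) \<sigma>)" "Suc n \<notin> set \<rho>" using p by auto
    then have "map (\<lambda>x. x + (n - i)) \<sigma> = map (\<lambda>x. x + (n - i')) \<sigma>'" "\<rho> = \<rho>'"
      using eq by (auto simp: append_Cons_eq_iff)
    moreover from this have "i = i'" using p(9) p'(9) by (metis length_map)
    ultimately show "t = t'" unfolding tt by (auto simp: inj_def)
  qed
  show "?f ` ?A = ?B"
  proof (intro equalityI subsetI)
    fix \<pi> assume "\<pi> \<in> ?f ` ?A"
    then obtain i \<sigma> \<rho> where A: "(i, \<sigma>, \<rho>) \<in> ?A"
      and \<pi>: "\<pi> = map (\<lambda>x. x + (n - i)) \<sigma> @ Suc n # \<rho>" by auto
    note p = props[OF A]
    let ?\<sigma> = "map (\<lambda>x. x + (n - i)) \<sigma>"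
    have "set ?\<sigma> = {n - i + 1..n}" unfolding set_map p(2) image_add_atLeastAtMost' using p(1) by simp
    then have set: "set \<pi> = {1..Suc n}" and less: "\<forall>a\<in>set (?\<sigma> @ \<rho>). a < Suc n"
      and ex: "exceeds ?\<sigma> \<rho>" and dist: "distinct \<pi>"
      using p by (auto simp: \<pi> exceeds_def distinct_map inj_on_def)
    moreover have "avoids \<pi> pattern_132"
      unfolding \<pi> contains_132_around_max_iff[OF less ex]
      unfolding contains_map_strict_mono[OF shift_strict_mono] using p by blast
    moreover have "P \<pi>" unfolding \<pi> P[OF less ex] Q by (fact p)
    ultimately show "\<pi> \<in> ?B" by (auto simp: av132_def permutations_of_set_def)
  next
    fix \<pi> assume "\<pi> \<in> ?B"
    then have \<pi>: "set \<pi> = {1..Suc n}" "distinct \<pi>" "avoids \<pi> pattern_132" "P \<pi>"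
      by (auto simp: av132_def permutations_of_set_def)
    then obtain \<sigma> \<rho> where eq: "\<pi> = \<sigma> @ Suc n # \<rho>" by (metis atLeastAtMost_iff le_add1 le_refl plus_1_eq_Suc split_list)
    have un: "set \<sigma> \<union> set \<rho> = {1..n}"
    proof -
      have "set \<sigma> \<union> set \<rho> = set \<pi> - {Suc n}" using \<pi>(2) by (auto simp: eq)
      also have "\<dots> = {1..n}" unfolding \<pi>(1) by auto
      finally show ?thesis .
    qed
    then have less: "\<forall>a\<in>set (\<sigma> @ \<rho>). a < Suc n" by auto
    have ex: "exceeds \<sigma> \<rho>" using exceeds_if_avoids_132 \<pi> less unfolding eq by blast
    define r where "r = length \<rho>"
    have card: "card (set \<rho>) = r" using \<pi>(2) by (auto simp: eq r_def distinct_card)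
    have sets: "set \<rho> = {1..r}" "set \<sigma> = {r + 1..n}"
      using down_closed_eq_atLeastAtMost[OF un] ex unfolding card exceeds_def by auto
    have "r \<le> n" using un sets(1) by (cases "r = 0") auto
    \<comment> \<open>Standardization of \<open>\<sigma>\<close>: all its letters exceed
      \<open>r\<close>, so the truncated subtraction is reversible.\<close>
    define \<sigma>' where "\<sigma>' = map (\<lambda>x. x - r) \<sigma>"
    have \<sigma>: "\<sigma> = map (\<lambda>x. x + r) \<sigma>'"
      using map_idI[of \<sigma> "\<lambda>x. x - r + r"] sets(2) by (simp add: \<sigma>'_def comp_def)
    have "set \<sigma>' = {1..n - r}"
    proof -
      have "(\<lambda>x. x + r) ` set \<sigma>' = {r + 1..n}" using sets(2) \<sigma> by (metis set_map)
      also have "\<dots> = (\<lambda>x. x + r) ` {1..n - r}"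
        unfolding image_add_atLeastAtMost' using \<open>r \<le> n\<close> by simp
      finally show ?thesis by (subst (asm) inj_image_eq_iff) (auto simp: inj_def)
    qed
    moreover have "distinct \<sigma>'" using \<pi>(2) by (auto simp: eq \<sigma> distinct_map)
    moreover have "avoids \<sigma>' pattern_132" "avoids \<rho> pattern_132"
      using \<pi>(3) unfolding eq contains_132_around_max_iff[OF less ex]
      by (simp_all add: \<sigma> contains_map_strict_mono[OF shift_strict_mono])
    moreover have "Q \<sigma>' \<rho>" using \<pi>(4) unfolding eq P[OF less ex] unfolding \<sigma> Q .
    moreover have "distinct \<rho>" using \<pi>(2) by (simp add: eq)
    ultimately have "(n - r, \<sigma>', \<rho>) \<in> ?A"
      using \<open>r \<le> n\<close> sets(1) by (auto simp: av132_def permutations_of_set_def)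
    moreover have "\<pi> = ?f (n - r, \<sigma>', \<rho>)" using \<open>r \<le> n\<close> by (simp add: eq \<sigma>)
    ultimately show "\<pi> \<in> ?f ` ?A" by blast
  qed
qed

text \<open>The alternatives exclude each other on \<open>\<sigma>\<close>, so the pairs are counted
  by a sum of two products, and summing over \<open>i\<close> gives convolutions. Shift invariance
  is asked of \<open>A\<close> and \<open>A'\<close> only, because only \<open>\<sigma>\<close> is
  raised. Recursions with one product take \<open>A'\<close> and \<open>B'\<close> constantly
  false.\<close>

lemma av132_fps_rec:
  assumes P: "\<And>\<sigma> m \<rho>. \<forall>a\<in>set (\<sigma> @ \<rho>). a < m \<Longrightarrow> exceeds \<sigma> \<rho> \<Longrightarrow>
      P (\<sigma> @ m # \<rho>) \<longleftrightarrow> A \<sigma> \<and> B \<rho> \<or> A' \<sigma> \<and> B' \<rho>"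
    and A: "\<And>\<sigma> c. A (map (\<lambda>x. x + c) \<sigma>) \<longleftrightarrow> A \<sigma>" "\<And>\<sigma> c. A' (map (\<lambda>x. x + c) \<sigma>) \<longleftrightarrow> A' \<sigma>"
    and disj: "\<And>\<sigma>. \<not> (A \<sigma> \<and> A' \<sigma>)"
    and Nil: "P []"
  shows "av132_fps P = 1 + fps_X * (av132_fps A * av132_fps B + av132_fps A' * av132_fps B')"
proof (rule fps_ext)
  fix n
  show "fps_nth (av132_fps P) n =
    fps_nth (1 + fps_X * (av132_fps A * av132_fps B + av132_fps A' * av132_fps B')) n"
  proof (cases n)
    case 0
    have "av132 P 0 = {[]}" using Nil
      by (auto simp: av132_def contains_132_iff)
    with 0 show ?thesis by (simp add: av132_fps_def)
  next
    case (Suc k)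
    let ?T = "\<lambda>i. {(\<sigma>, \<rho>) \<in> av132 (\<lambda>_. True) i \<times> av132 (\<lambda>_. True) (k - i). A \<sigma> \<and> B \<rho> \<or> A' \<sigma> \<and> B' \<rho>}"
    have T: "?T i = av132 A i \<times> av132 B (k - i) \<union> av132 A' i \<times> av132 B' (k - i)" for i
      by (auto simp: av132_def)
    have finT: "finite (?T i)" for i unfolding T by (simp add: finite_av132)
    have cardT: "card (?T i) = card (av132 A i) * card (av132 B (k - i)) +
        card (av132 A' i) * card (av132 B' (k - i))" for i
      unfolding T using disj
      by (subst card_Un_disjoint) (auto simp: finite_av132 card_cartesian_product, auto simp: av132_def)
    have "card (av132 P (Suc k)) = card (SIGMA i:{..k}. ?T i)"
      using bij_betw_same_card[OF bij_betw_av132_Suc[of P "\<lambda>\<sigma> \<rho>. A \<sigma> \<and> B \<rho> \<or> A' \<sigma> \<and> B' \<rho>" k]] P A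
      by simp
    also have "\<dots> = (\<Sum>i\<le>k. card (?T i))"
      by (rule card_SigmaI, simp, intro ballI finT)
    finally have "card (av132 P (Suc k)) = (\<Sum>i\<le>k. card (av132 A i) * card (av132 B (k - i)) +
        card (av132 A' i) * card (av132 B' (k - i)))" unfolding cardT .
    moreover have "fps_nth (av132_fps V * av132_fps W) k =
        of_nat (\<Sum>i\<le>k. card (av132 V i) * card (av132 W (k - i)))" for V W
      by (simp add: av132_fps_def fps_mult_nth atLeast0AtMost)
    moreover have "fps_nth (av132_fps P) (Suc k) = of_nat (card (av132 P (Suc k)))"
      by (simp add: av132_fps_def)
    ultimately show ?thesis unfolding Suc by (simp add: sum.distrib)
  qed
qed

section \<open>Functional equations for the series\<close>

lemma F_avoid_132: "F_avoid pattern_132 = 1 + fps_X * (F_avoid pattern_132 * F_avoid pattern_132)"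
proof -
  let ?P = "\<lambda>\<pi>. avoids \<pi> pattern_132"
  have "av132_fps ?P = 1 + fps_X * (av132_fps ?P * av132_fps ?P +
    av132_fps (\<lambda>_. False) * av132_fps (\<lambda>_. False))"
    by (rule av132_fps_rec)
       (auto simp: contains_132_around_max_iff contains_map_strict_mono[OF shift_strict_mono]
         contains_132_iff[of "[]"])
  then show ?thesis by (simp add: F_avoid_eq_av132_fps av132_fps_False)
qed

lemma F_avoid_eq_F_avoid_132:
  assumes "\<And>\<pi>. contains \<pi> \<tau> \<Longrightarrow> contains \<pi> pattern_132"
  shows "F_avoid \<tau> = F_avoid pattern_132"
proof -
  have "{\<pi> \<in> permutations_of_set {1..n}. avoids \<pi> pattern_132 \<and> avoids \<pi> \<tau>} =
    {\<pi> \<in> permutations_of_set {1..n}. avoids \<pi> pattern_132 \<and> avoids \<pi> pattern_132}" for n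
    using assms by blast
  then show ?thesis by (simp add: F_avoid_def f_avoid_def)
qed

text \<open>The last letter \<open>d\<close> is the maximal one. If \<open>m\<close> plays it, all
  of \<open>\<tau>\<close> lies in \<open>\<sigma>\<close>. A proper cut is impossible, as a letter
  of \<open>\<tau>\<close> on the left would have to exceed \<open>d\<close> on the right. So
  avoidance means that \<open>\<sigma>\<close> avoids \<open>\<tau>\<close> and
  \<open>\<rho>\<close> avoids \<open>\<tau> @ [[d]]\<close>.\<close>

lemma F_avoid_append_max:
  assumes ne: "[] \<notin> set \<tau>" and d: "\<forall>a\<in>set (letters \<tau>). a < d"
  shows "F_avoid (\<tau> @ [[d]]) = 1 + fps_X * (F_avoid \<tau> * F_avoid (\<tau> @ [[d]]))"
proof -
  let ?P = "\<lambda>\<pi>. avoids \<pi> (\<tau> @ [[d]])" and ?A = "\<lambda>\<pi>. avoids \<pi> \<tau>"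
  have iff: "contains (\<sigma> @ m # \<rho>) (\<tau> @ [[d]]) \<longleftrightarrow> contains \<sigma> \<tau> \<or> contains \<rho> (\<tau> @ [[d]])"
    if "\<forall>a\<in>set (\<sigma> @ \<rho>). a < m" "exceeds \<sigma> \<rho>" for \<sigma> \<rho> m
  proof -
    have cut: "\<alpha> = [] \<or> \<beta> = []"
      if eq: "\<tau> @ [[d]] = \<alpha> @ \<beta>" and ex: "exceeds (letters \<alpha>) (letters \<beta>)" for \<alpha> \<beta>
    proof (rule ccontr)
      assume c: "\<not> (\<alpha> = [] \<or> \<beta> = [])"
      then obtain \<gamma> where "\<beta> = \<gamma> @ [[d]]" "\<tau> = \<alpha> @ \<gamma>" using eq
        by (cases \<beta> rule: rev_cases) auto
      moreover from c obtain w \<alpha>' where "\<alpha> = w # \<alpha>'" by (cases \<alpha>) auto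
      moreover from calculation ne obtain a where "a \<in> set w" by (cases w) auto
      ultimately have "a < d" "d < a" using ex d by (auto simp: exceeds_def)
      then show False by simp
    qed
    have "contains (\<sigma> @ m # \<rho>) (\<tau> @ [[d]]) \<longleftrightarrow>
      (\<exists>\<alpha> \<beta>. \<tau> @ [[d]] = \<alpha> @ \<beta> \<and> exceeds (letters \<alpha>) (letters \<beta>) \<and> contains \<sigma> \<alpha> \<and> contains \<rho> \<beta>) \<or>
      contains \<sigma> \<tau>"
      using contains_around_max_iff[of \<tau> d "[]" \<sigma> \<rho> m] ne d that
      by (simp add: contains_empty_pattern exceeds_def)
    also have "\<dots> \<longleftrightarrow> contains \<sigma> (\<tau> @ [[d]]) \<or> contains \<rho> (\<tau> @ [[d]]) \<or> contains \<sigma> \<tau>"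
    proof -
      \<comment> \<open>An empty part satisfies \<open>exceeds\<close> vacuously, so the trivial
        cuts yield the occurrences inside one side.\<close>
      have "exceeds [] zs" "exceeds zs []" for zs by (auto simp: exceeds_def)
      then show ?thesis using cut contains_empty_pattern
        by (metis append.left_neutral append.right_neutral concat.simps(1))
    qed
    also have "\<dots> \<longleftrightarrow> contains \<sigma> \<tau> \<or> contains \<rho> (\<tau> @ [[d]])"
      using contains_append_left[of \<tau> "[[d]]"] ne by auto
    finally show ?thesis .
  qed
  have "av132_fps ?P = 1 + fps_X * (av132_fps ?A * av132_fps ?P +
    av132_fps (\<lambda>_. False) * av132_fps (\<lambda>_. False))"
    by (rule av132_fps_rec)
       (auto simp: iff contains_map_strict_mono[OF shift_strict_mono] dest: contains_empty_list)
  then show ?thesis by (simp add: F_avoid_eq_av132_fps av132_fps_False)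
qed

lemma F_avoid_rec:
  assumes ne: "[] \<notin> set (\<tau>' @ [[k]] @ \<tau>'' @ [[d]])" and "\<tau>' \<noteq> []"
    and \<tau>': "\<forall>a\<in>set (letters \<tau>'). d < a \<and> a < k"
    and \<tau>'': "\<forall>a\<in>set (letters \<tau>''). a < d"
  defines "\<tau> \<equiv> \<tau>' @ [[k]] @ \<tau>'' @ [[d]]"
  shows "F_avoid \<tau> = 1 + fps_X * (F_avoid \<tau>' * F_avoid \<tau> +
    (F_avoid \<tau> - F_avoid \<tau>') * F_avoid (\<tau>'' @ [[d]]))"
proof -
  have nes: "[] \<notin> set \<tau>'" "[] \<notin> set \<tau>''" using ne by auto
  obtain a where a: "a \<in> set (letters \<tau>')"
    using \<open>\<tau>' \<noteq> []\<close> nes(1) by (cases \<tau>'; cases "hd \<tau>'") auto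
  then have "d < k" using \<tau>' by force
  have sub: "contains \<pi> \<tau> \<Longrightarrow> contains \<pi> \<tau>'" "contains \<pi> \<tau> \<Longrightarrow> contains \<pi> (\<tau>'' @ [[d]])" for \<pi>
    using contains_append_left[of \<tau>' "[[k]] @ \<tau>'' @ [[d]]"]
      contains_append_right[of "\<tau>' @ [[k]]" "\<tau>'' @ [[d]]"] ne unfolding \<tau>_def by auto
  have ex0: "exceeds [] zs" "exceeds zs []" for zs by (auto simp: exceeds_def)
  \<comment> \<open>A nonempty left part contains a letter \<open>b < k\<close> of
    \<open>\<tau>'\<close>; were \<open>k\<close> on the right, \<open>b\<close> would have to
    exceed it. With \<open>k\<close> on the left, the left part cannot reach into
    \<open>\<tau>''\<close>, whose letters lie below the final \<open>d\<close> on the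
    right.\<close>
  have cut: "\<alpha> = [] \<or> \<beta> = [] \<or> \<alpha> = \<tau>' @ [[k]] \<and> \<beta> = \<tau>'' @ [[d]]"
    if eq: "\<tau> = \<alpha> @ \<beta>" and ex: "exceeds (letters \<alpha>) (letters \<beta>)" for \<alpha> \<beta>
  proof (rule ccontr)
    assume c: "\<not> ?thesis"
    then obtain w \<alpha>' where w: "\<alpha> = w # \<alpha>'" by (cases \<alpha>) auto
    then obtain b where b: "b \<in> set w" "b \<in> set (letters \<tau>')" using eq \<open>\<tau>' \<noteq> []\<close> nes(1)
      by (cases \<tau>'; cases w) (auto simp: \<tau>_def)
    then have "b < k" using \<tau>' by blast
    moreover have "\<forall>y\<in>set (letters \<beta>). y < b" using ex b(1) by (auto simp: w exceeds_def)
    ultimately have "k \<notin> set (letters \<beta>)" using order.asym by blast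
    then obtain \<gamma> where \<gamma>: "\<alpha> = \<tau>' @ [k] # \<gamma>" "\<tau>'' @ [[d]] = \<gamma> @ \<beta>"
      using eq by (auto simp: \<tau>_def append_eq_append_conv2 append_eq_Cons_conv Cons_eq_append_conv)
    obtain \<delta> where \<delta>: "\<beta> = \<delta> @ [[d]]" "\<tau>'' = \<gamma> @ \<delta>" using \<gamma>(2) c
      by (cases \<beta> rule: rev_cases) auto
    have "\<gamma> \<noteq> []" using c \<gamma> by auto
    then obtain e where "e \<in> set (letters \<gamma>)" using nes(2) \<delta>(2) by (cases \<gamma>; cases "hd \<gamma>") auto
    moreover from this have "e < d" using \<tau>'' \<delta>(2) by auto
    moreover have "e \<in> set (letters \<alpha>)" "d \<in> set (letters \<beta>)"
      using calculation(1) by (simp_all add: \<gamma>(1) \<delta>(1))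
    then have "d < e" using ex unfolding exceeds_def by blast
    ultimately show False by simp
  qed
  have iff: "contains (\<sigma> @ m # \<rho>) \<tau> \<longleftrightarrow>
      contains \<sigma> \<tau> \<or> contains \<rho> \<tau> \<or> contains \<sigma> \<tau>' \<and> contains \<rho> (\<tau>'' @ [[d]])"
    if "\<forall>a\<in>set (\<sigma> @ \<rho>). a < m" "exceeds \<sigma> \<rho>" for \<sigma> \<rho> m
  proof -
    have 1: "[] \<notin> set (\<tau>' @ [k] # \<tau>'' @ [[d]])" using ne by simp
    have 2: "\<forall>a\<in>set (letters (\<tau>' @ \<tau>'' @ [[d]])). a < k" using \<tau>' \<tau>'' \<open>d < k\<close>
      by (auto intro: order.strict_trans[of _ d])
    have 3: "exceeds (letters \<tau>') (letters (\<tau>'' @ [[d]]))"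
      unfolding exceeds_def
    proof (intro ballI)
      fix x y assume "x \<in> set (letters \<tau>')" "y \<in> set (letters (\<tau>'' @ [[d]]))"
      then have "d < x" "y \<le> d" using \<tau>' \<tau>'' by (auto simp: less_imp_le)
      then show "y < x" by simp
    qed
    have \<tau>: "\<tau>' @ [k] # \<tau>'' @ [[d]] = \<tau>" by (simp add: \<tau>_def)
    have "contains (\<sigma> @ m # \<rho>) \<tau> \<longleftrightarrow>
      (\<exists>\<alpha> \<beta>. \<tau> = \<alpha> @ \<beta> \<and> exceeds (letters \<alpha>) (letters \<beta>) \<and> contains \<sigma> \<alpha> \<and> contains \<rho> \<beta>) \<or>
      contains \<sigma> \<tau>' \<and> contains \<rho> (\<tau>'' @ [[d]])" (is "_ \<longleftrightarrow> ?cut \<or> ?max")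
      using contains_around_max_iff[OF 1 2 that] 3 unfolding \<tau> by blast
    also have "\<dots> \<longleftrightarrow> contains \<sigma> \<tau> \<or> contains \<rho> \<tau> \<or> ?max"
    proof -
      have "contains \<sigma> \<tau> \<or> contains \<rho> \<tau> \<or> ?max" if ?cut
      proof -
        from that obtain \<alpha> \<beta> where \<alpha>\<beta>: "\<tau> = \<alpha> @ \<beta>" "exceeds (letters \<alpha>) (letters \<beta>)"
          "contains \<sigma> \<alpha>" "contains \<rho> \<beta>" by blast
        \<comment> \<open>The cut right behind \<open>k\<close> gives nothing new: it is an instance
          of \<open>?max\<close>.\<close>
        have "contains \<sigma> \<tau>'" if "\<alpha> = \<tau>' @ [[k]]"
          using \<alpha>\<beta>(3) contains_append_left[of \<tau>' "[[k]]"] nes(1) unfolding that by auto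
        with cut[OF \<alpha>\<beta>(1,2)] \<alpha>\<beta> show ?thesis by auto
      qed
      moreover have ?cut if "contains \<sigma> \<tau>"
        using that ex0 contains_empty_pattern by (intro exI[of _ \<tau>] exI[of _ "[]"]) auto
      moreover have ?cut if "contains \<rho> \<tau>"
        using that ex0 contains_empty_pattern by (intro exI[of _ "[]"] exI[of _ \<tau>]) auto
      ultimately show ?thesis by blast
    qed
    finally show ?thesis .
  qed
  let ?P = "\<lambda>\<pi>. avoids \<pi> \<tau>" and ?A = "\<lambda>\<pi>. avoids \<pi> \<tau>'" and ?D = "\<lambda>\<pi>. avoids \<pi> (\<tau>'' @ [[d]])"
  \<comment> \<open>If \<open>\<sigma>\<close> avoids \<open>\<tau>'\<close>, only
    \<open>\<rho>\<close> has to avoid \<open>\<tau>\<close>. If \<open>\<sigma>\<close> contains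
    \<open>\<tau>'\<close>, it has to avoid \<open>\<tau>\<close> while \<open>\<rho>\<close> avoids
    \<open>\<tau>'' @ [[d]]\<close>. By \<open>sub\<close> the remaining conditions follow.\<close>
  have "av132_fps ?P = 1 + fps_X * (av132_fps ?A * av132_fps ?P +
    av132_fps (\<lambda>\<pi>. ?P \<pi> \<and> \<not> ?A \<pi>) * av132_fps ?D)"
  proof (rule av132_fps_rec)
    show "?P []" using contains_empty_list[of \<tau>] by (auto simp: \<tau>_def)
  qed (use iff sub in \<open>auto simp: contains_map_strict_mono[OF shift_strict_mono]\<close>)
  also have "av132_fps (\<lambda>\<pi>. ?P \<pi> \<and> \<not> ?A \<pi>) = av132_fps ?P - av132_fps ?A"
    by (rule av132_fps_diff) (use sub in blast)
  finally show ?thesis by (simp add: F_avoid_eq_av132_fps)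
qed

section \<open>The nested fraction\<close>

text \<open>Both denominators have constant term 1, so they are units and the divisions are exact.
  The hypothesis is the identity with denominators cleared, a form accessible to
  \<open>algebra\<close>.\<close>

lemma fps_eq_nested_fractionI:
  fixes A F G :: "rat fps"
  assumes "A * (1 - fps_X * (F + G) - fps_X * (1 - fps_X * F * G)) = 1 - fps_X * (F + G)"
  shows "A = 1 / (1 - fps_X * ((1 - fps_X * F * G) / (1 - fps_X * (F + G))))"
proof -
  define D where "D = 1 - fps_X * (F + G)"
  define N where "N = (1 - fps_X * F * G) / D"
  have D0: "fps_nth D 0 \<noteq> 0" by (simp add: D_def)
  have ND: "N * D = 1 - fps_X * F * G"
    unfolding N_def using D0 by (simp add: fps_divide_unit mult.assoc inverse_mult_eq_1)
  have N0: "fps_nth (1 - fps_X * N) 0 \<noteq> 0" by simp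
  have "D * (A * (1 - fps_X * N)) = A * (D - fps_X * (N * D))" by (simp add: algebra_simps)
  also have "\<dots> = D * 1" using assms unfolding ND by (simp add: D_def)
  finally have "A * (1 - fps_X * N) = 1" using D0 by (metis fps_zero_nth mult_left_cancel)
  then have "A = 1 / (1 - fps_X * N)"
    using N0 by (metis fps_divide_unit fps_inverse_unique mult.commute mult_1)
  then show ?thesis unfolding N_def D_def .
qed

text \<open>The last hypothesis cannot be dropped: for 2-4-3-1 with \<open>k = 4\<close> and
  \<open>d = 1\<close> the left side is the Catalan series, whereas both inner series are 1 and the
  right side is rational.\<close>

theorem theorem2p15:
  fixes \<tau> \<tau>' \<tau>'' :: gpattern and k d :: nat
  assumes "d < k"
    and "gen_pattern \<tau>"
    and "set (letters \<tau>) = {1..k}"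
    and "\<tau> = \<tau>' @ [[k]] @ \<tau>'' @ [[d]]"
    and "\<tau>' \<noteq> []" and "Min (set (letters \<tau>')) = d + 1"
    and "contains (letters \<tau>) pattern_132 \<Longrightarrow>
           contains (letters \<tau>') pattern_132 \<or> contains (letters \<tau>'') pattern_132"
  shows "F_avoid \<tau> =
    1 / (1 - fps_X * ((1 - fps_X * F_avoid \<tau>' * F_avoid \<tau>'') /
                      (1 - fps_X * (F_avoid \<tau>' + F_avoid \<tau>''))))"
proof (rule fps_eq_nested_fractionI)
  let ?F = "F_avoid \<tau>'" and ?G = "F_avoid \<tau>''" and ?C = "F_avoid pattern_132"
  have ne: "[] \<notin> set (\<tau>' @ [[k]] @ \<tau>'' @ [[d]])"
    and dist: "distinct (letters (\<tau>' @ [[k]] @ \<tau>'' @ [[d]]))"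
    using assms(2) unfolding assms(4) gen_pattern_def by auto
  show "F_avoid \<tau> * (1 - fps_X * (?F + ?G) - fps_X * (1 - fps_X * ?F * ?G)) = 1 - fps_X * (?F + ?G)"
  proof (cases "contains (letters \<tau>') pattern_132 \<or> contains (letters \<tau>'') pattern_132")
    case True
    have sub: "contains \<pi> \<tau> \<Longrightarrow> contains \<pi> \<tau>'" "contains \<pi> \<tau> \<Longrightarrow> contains \<pi> \<tau>''" for \<pi>
    proof -
      assume *: "contains \<pi> \<tau>"
      then show "contains \<pi> \<tau>'"
        using contains_append_left[of \<tau>' "[[k]] @ \<tau>'' @ [[d]]"] ne unfolding assms(4) by auto
      from * have "contains \<pi> (\<tau>'' @ [[d]])"
        using contains_append_right[of "\<tau>' @ [[k]]" "\<tau>'' @ [[d]]"] ne unfolding assms(4) by auto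
      then show "contains \<pi> \<tau>''" using contains_append_left[of \<tau>'' "[[d]]"] ne by auto
    qed
    have C: "?C = 1 + fps_X * (?C * ?C)" by (rule F_avoid_132)
    have \<tau>: "F_avoid \<tau> = ?C"
      using True sub contains_132_if_contains by (intro F_avoid_eq_F_avoid_132) blast
    from True have "?F = ?C \<or> ?G = ?C"
      using contains_132_if_contains by (metis F_avoid_eq_F_avoid_132)
    then show ?thesis unfolding \<tau>
    proof
      assume "?F = ?C"
      \<comment> \<open>Expand the left side and replace \<open>x C^2\<close> by
        \<open>C - 1\<close>, once alone and once inside the product with
        \<open>x G\<close>.\<close>
      with C show "?C * (1 - fps_X * (?F + ?G) - fps_X * (1 - fps_X * ?F * ?G)) =
        1 - fps_X * (?F + ?G)" by algebra
    next
      assume "?G = ?C"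
      with C show "?C * (1 - fps_X * (?F + ?G) - fps_X * (1 - fps_X * ?F * ?G)) =
        1 - fps_X * (?F + ?G)" by algebra
    qed
  next
    case False
    then have av: "avoids (letters \<tau>) pattern_132" using assms(7) by blast
    have le: "\<forall>a\<in>set (letters \<tau>). a \<le> k" unfolding assms(3) by simp
    have \<tau>': "\<forall>a\<in>set (letters \<tau>'). d < a \<and> a < k"
    proof
      fix a assume a: "a \<in> set (letters \<tau>')"
      then have "d + 1 \<le> a" unfolding assms(6)[symmetric] by (intro Min_le) auto
      moreover have "a \<le> k" "a \<noteq> k" using a le dist unfolding assms(4) by auto
      ultimately show "d < a \<and> a < k" by simp
    qed
    \<comment> \<open>Avoidance of 1-3-2 by the pattern's own letters, with \<open>k\<close> as
      maximum, puts \<open>\<tau>'\<close> above \<open>\<tau>''\<close>. As \<open>d + 1\<close>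
      belongs to \<open>\<tau>'\<close>, the letters of \<open>\<tau>''\<close> are at most
      \<open>d\<close>, and distinctness excludes \<open>d\<close>.\<close>
    have "exceeds (letters \<tau>') (letters \<tau>'' @ [d])"
    proof (rule exceeds_if_avoids_132)
      show "distinct (letters \<tau>' @ k # letters \<tau>'' @ [d])" using dist by simp
      show "avoids (letters \<tau>' @ k # letters \<tau>'' @ [d]) pattern_132" using av by (simp add: assms(4))
      show "\<forall>a\<in>set (letters \<tau>' @ letters \<tau>'' @ [d]). a < k"
        using le dist unfolding assms(4) by (auto simp: less_le)
    qed
    moreover have "d + 1 \<in> set (letters \<tau>')"
    proof -
      have "letters \<tau>' \<noteq> []" using assms(5) ne by (cases \<tau>') auto
      then show ?thesis unfolding assms(6)[symmetric] by (intro Min_in) auto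
    qed
    ultimately have "\<forall>a\<in>set (letters \<tau>''). a < d + 1" by (auto simp: exceeds_def)
    moreover have "d \<notin> set (letters \<tau>'')" using dist by auto
    ultimately have \<tau>'': "\<forall>a\<in>set (letters \<tau>''). a < d" by (metis Suc_eq_plus1 less_antisym)
    let ?A = "F_avoid \<tau>" and ?H = "F_avoid (\<tau>'' @ [[d]])"
    have "?A = 1 + fps_X * (?F * ?A + (?A - ?F) * ?H)"
      unfolding assms(4) by (rule F_avoid_rec[OF ne assms(5) \<tau>' \<tau>''])
    moreover have "?H = 1 + fps_X * (?G * ?H)"
      using ne \<tau>'' by (intro F_avoid_append_max) auto
    \<comment> \<open>Multiplying the equation for \<open>?A\<close> by
      \<open>1 - fps_X * ?G\<close> eliminates \<open>?H\<close>, since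
      \<open>?H * (1 - fps_X * ?G) = 1\<close>.\<close>
    ultimately show ?thesis by algebra
  qed
qed

end
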